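(* Let $(X,\mathcal{C})$ be a point-meager Baire base such that $\mathcal{C}$ satisfies CCC (the countable chain condition) and every region has cardinality $\aleph_1$. Then there exists a uniform non-Baire family $\mathcal{F}$ of subsets of $X$ which induces a decomposition of $X$, i.e. the members of $\mathcal{F}$ form a partition of $X$.
   Context: A category base is a pair $(X,\mathcal{C})$ where $X$ is a non-empty set and $\mathcal{C}$ is a family of subsets of $X$, called regions, satisfying the following axioms. (1) Every point of $X$ belongs to some region, i.e. $X=\bigcup\mathcal{C}$. (2) Let $A$ be a region and $\mathcal{D}$ a non-empty family of disjoint regions having cardinality less than the cardinality of $\mathcal{C}$. (i) If $A\cap(\bigcup\mathcal{D})$ contains a region, then there is a region $D\in\mathcal{D}$ such that $A\cap D$ contains a region. (ii) If $A\cap(\bigcup\mathcal{D})$ contains no region, then there is a region $B\subseteq A$ that is disjoint from every region in $\mathcal{D}$. A subregion of a region $C$ is a region contained in $C$. A set is singular if every region contains a subregion which is disjoint from the set. A set is meager if it can be expressed as a countable union of singular sets; otherwise it is abundant. A set $S\subseteq X$ is meager (abundant) in a region $D$ if $S\cap D$ is meager (abundant). A set $S\subseteq X$ is Baire if in every region there is a subregion in which either $S$ or its complement $X-S$ is meager; a set is non-Baire if it is not Baire. A category base is point-meager if all countable sets are meager, and it is a Baire base if all its regions are abundant sets. CCC means that every family of pairwise disjoint regions is countable. A test region for a non-Baire set $S$ is a region in every subregion of which both $S$ and $X-S$ are abundant. A family $\mathcal{F}$ of non-Baire sets is a uniform non-Baire family if there is a region in $\mathcal{C}$ which is a test region for every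 member of $\mathcal{F}$ simultaneously. *)

theory Defs
  imports "HOL-Library.Disjoint_Sets" "HOL-Library.Countable_Set"
begin

unbundle cardinal_syntax

definition category_base :: "'a set \<Rightarrow> 'a set set \<Rightarrow> bool" where
  "category_base X C \<longleftrightarrow>
     X \<noteq> {} \<and> X = \<Union>C \<and>
     (\<forall>A\<in>C. \<forall>D. D \<noteq> {} \<and> D \<subseteq> C \<and> disjoint D \<and> |D| <o |C| \<longrightarrow>
        ((\<exists>B\<in>C. B \<subseteq> A \<inter> \<Union>D) \<longrightarrow> (\<exists>E\<in>D. \<exists>B\<in>C. B \<subseteq> A \<inter> E)) \<and>
        (\<not> (\<exists>B\<in>C. B \<subseteq> A \<inter> \<Union>D) \<longrightarrow> (\<exists>B\<in>C. B \<subseteq> A \<and> (\<forall>E\<in>D. B \<inter> E = {}))))"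

definition singular :: "'a set \<Rightarrow> 'a set set \<Rightarrow> 'a set \<Rightarrow> bool" where
  "singular X C S \<longleftrightarrow> S \<subseteq> X \<and> (\<forall>A\<in>C. \<exists>B\<in>C. B \<subseteq> A \<and> B \<inter> S = {})"

definition meager :: "'a set \<Rightarrow> 'a set set \<Rightarrow> 'a set \<Rightarrow> bool" where
  "meager X C S \<longleftrightarrow> (\<exists>N. countable N \<and> (\<forall>T\<in>N. singular X C T) \<and> S = \<Union>N)"

definition abundant :: "'a set \<Rightarrow> 'a set set \<Rightarrow> 'a set \<Rightarrow> bool" where
  "abundant X C S \<longleftrightarrow> S \<subseteq> X \<and> \<not> meager X C S"

definition meager_in :: "'a set \<Rightarrow> 'a set set \<Rightarrow> 'a set \<Rightarrow> 'a set \<Rightarrow> bool" where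
  "meager_in X C S D \<longleftrightarrow> meager X C (S \<inter> D)"

definition abundant_in :: "'a set \<Rightarrow> 'a set set \<Rightarrow> 'a set \<Rightarrow> 'a set \<Rightarrow> bool" where
  "abundant_in X C S D \<longleftrightarrow> abundant X C (S \<inter> D)"

definition Baire_set :: "'a set \<Rightarrow> 'a set set \<Rightarrow> 'a set \<Rightarrow> bool" where
  "Baire_set X C S \<longleftrightarrow> S \<subseteq> X \<and>
     (\<forall>A\<in>C. \<exists>B\<in>C. B \<subseteq> A \<and> (meager_in X C S B \<or> meager_in X C (X - S) B))"

definition non_Baire_set :: "'a set \<Rightarrow> 'a set set \<Rightarrow> 'a set \<Rightarrow> bool" where
  "non_Baire_set X C S \<longleftrightarrow> S \<subseteq> X \<and> \<not> Baire_set X C S"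

definition point_meager :: "'a set \<Rightarrow> 'a set set \<Rightarrow> bool" where
  "point_meager X C \<longleftrightarrow> (\<forall>S. S \<subseteq> X \<and> countable S \<longrightarrow> meager X C S)"

definition Baire_base :: "'a set \<Rightarrow> 'a set set \<Rightarrow> bool" where
  "Baire_base X C \<longleftrightarrow> (\<forall>A\<in>C. abundant X C A)"

definition countable_chain_condition :: "'a set set \<Rightarrow> bool" where
  "countable_chain_condition C \<longleftrightarrow> (\<forall>D. D \<subseteq> C \<and> disjoint D \<longrightarrow> countable D)"

definition test_region :: "'a set \<Rightarrow> 'a set set \<Rightarrow> 'a set \<Rightarrow> 'a set \<Rightarrow> bool" where
  "test_region X C S T \<longleftrightarrow> T \<in> C \<and>
     (\<forall>B\<in>C. B \<subseteq> T \<longrightarrow> abundant_in X C S B \<and> abundant_in X C (X - S) B)"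

definition uniform_non_Baire_family :: "'a set \<Rightarrow> 'a set set \<Rightarrow> 'a set set \<Rightarrow> bool" where
  "uniform_non_Baire_family X C F \<longleftrightarrow>
     (\<forall>S\<in>F. non_Baire_set X C S) \<and> (\<exists>T\<in>C. \<forall>S\<in>F. test_region X C S T)"

end

theory Submission
  imports Defs "HOL-Library.Countable_Set_Type"
begin

text \<open>
  The definition of a Baire set says that any non-Baire set \<open>S\<close> has a test region, and this
  region also tests \<open>X - S\<close>; so \<open>{S, X - S}\<close> works as soon as one non-Baire set exists.
  Suppose there is none. A Ulam matrix on a region of size \<open>\<aleph>\<^sub>1\<close> yields uncountably many pairwise
  disjoint abundant sets. By the countable chain condition, each of them, being Baire, is
  comeager in some region, and no two of these regions have a common subregion. Shrinking them
  to disjoint regions contradicts the countable chain condition.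
\<close>

section \<open>Maximal disjoint families\<close>

text \<open>Zorn's lemma: two members of the union of a chain already lie in one link. Under the
  countable chain condition this thins a family of regions to a countable one that still meets each
  of them. The guard \<open>B \<noteq> {}\<close> is there because the empty set meets
  nothing.\<close>

lemma exists_maximal_disjoint_subfamily:
  obtains M where "M \<subseteq> P" "disjoint M" "\<forall>B\<in>P. B \<noteq> {} \<longrightarrow> (\<exists>E\<in>M. B \<inter> E \<noteq> {})"
proof -
  have "\<exists>M\<in>{D. D \<subseteq> P \<and> disjoint D}. \<forall>D\<in>{D. D \<subseteq> P \<and> disjoint D}. M \<subseteq> D \<longrightarrow> D = M"
  proof (rule subset_Zorn')
    fix K assume K: "subset.chain {D. D \<subseteq> P \<and> disjoint D} K"
    have "disjoint (\<Union>K)"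
    proof (rule disjointI)
      fix a b assume "a \<in> \<Union>K" "b \<in> \<Union>K" and ab: "a \<noteq> b"
      then obtain D E where DE: "D \<in> K" "E \<in> K" "a \<in> D" "b \<in> E" by blast
      then have "D \<subseteq> E \<or> E \<subseteq> D" and "disjoint D" "disjoint E"
        using K by (auto simp: subset_chain_def)
      then show "a \<inter> b = {}" using DE ab disjointD by blast
    qed
    then show "\<Union>K \<in> {D. D \<subseteq> P \<and> disjoint D}"
      using K by (auto simp: subset_chain_def)
  qed
  then obtain M where "M \<in> {D. D \<subseteq> P \<and> disjoint D}"
    and "\<forall>D\<in>{D. D \<subseteq> P \<and> disjoint D}. M \<subseteq> D \<longrightarrow> D = M" by (rule bexE)
  then have M: "M \<subseteq> P" "disjoint M" and max: "\<And>D. \<lbrakk>D \<subseteq> P; disjoint D; M \<subseteq> D\<rbrakk> \<Longrightarrow> D = M"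
    by simp_all
  have "\<exists>E\<in>M. B \<inter> E \<noteq> {}" if "B \<in> P" "B \<noteq> {}" for B
  proof (rule ccontr)
    assume B: "\<not> ?thesis"
    then have "disjoint (insert B M)"
      using M(2) by (simp add: pairwise_insert disjnt_def Int_commute)
    then have "insert B M = M" by (intro max) (use that M in auto)
    then have "B \<in> M" by blast
    then show False using B that(2) by blast
  qed
  then show thesis using that[OF M] by blast
qed

section \<open>The sigma-ideal of meager sets\<close>

lemma singular_subset: "\<lbrakk>singular X C S; T \<subseteq> S\<rbrakk> \<Longrightarrow> singular X C T"
  unfolding singular_def by (meson disjoint_iff subset_iff)

lemma singular_imp_meager: "singular X C S \<Longrightarrow> meager X C S"
  unfolding meager_def by (rule exI[of _ "{S}"]) auto

lemma meager_subset:
  assumes "meager X C S" "T \<subseteq> S"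
  shows "meager X C T"
proof -
  obtain N where N: "countable N" "\<forall>S\<in>N. singular X C S" "S = \<Union>N"
    using assms(1) unfolding meager_def by blast
  show ?thesis unfolding meager_def
  proof (intro exI conjI)
    show "countable ((\<lambda>S. T \<inter> S) ` N)" using N by simp
    show "\<forall>S\<in>(\<lambda>S. T \<inter> S) ` N. singular X C S"
      using N singular_subset by fastforce
    show "T = \<Union>((\<lambda>S. T \<inter> S) ` N)" using N assms(2) by blast
  qed
qed

lemma meager_UN:
  assumes "countable I" "\<And>i. i \<in> I \<Longrightarrow> meager X C (S i)"
  shows "meager X C (\<Union>i\<in>I. S i)"
proof -
  have "\<forall>i\<in>I. \<exists>N. countable N \<and> (\<forall>T\<in>N. singular X C T) \<and> S i = \<Union>N"
    using assms(2) by (simp add: meager_def)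
  from bchoice[OF this] obtain N
    where N: "\<forall>i\<in>I. countable (N i) \<and> (\<forall>T\<in>N i. singular X C T) \<and> S i = \<Union>(N i)" ..
  show ?thesis unfolding meager_def
  proof (intro exI conjI)
    show "countable (\<Union>i\<in>I. N i)" using N assms(1) by blast
    show "\<forall>T\<in>(\<Union>i\<in>I. N i). singular X C T" using N by blast
    show "(\<Union>i\<in>I. S i) = \<Union>(\<Union>i\<in>I. N i)" using N by auto
  qed
qed

lemma meager_Un:
  assumes "meager X C S" "meager X C T"
  shows "meager X C (S \<union> T)"
proof -
  have "meager X C (\<Union>i\<in>{S, T}. i)" by (rule meager_UN) (use assms in auto)
  then show ?thesis by simp
qed

text \<open>
  The Ulam matrix has the entries \<open>U n b = {a \<in> A. b < a \<and> f a b = n}\<close>, where \<open>f a\<close> enumerates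
  the predecessors of \<open>a\<close> in a well-order of type \<open>\<omega>\<^sub>1\<close>.
\<close>

lemma Ulam_matrix:
  fixes A :: "'a set"
  assumes A: "|A| =o cardSuc natLeq" and "\<not> null A"
    and null_UN: "\<And>S :: nat \<Rightarrow> 'a set. (\<And>n. null (S n)) \<Longrightarrow> null (\<Union>n. S n)"
    and null_Un: "\<And>S T. \<lbrakk>null S; null T\<rbrakk> \<Longrightarrow> null (S \<union> T)"
    and null_countable: "\<And>S. \<lbrakk>S \<subseteq> A; countable S\<rbrakk> \<Longrightarrow> null S"
  obtains I :: "'a set" and S :: "'a \<Rightarrow> 'a set" where "uncountable I" "disjoint_family_on S I"
    "\<forall>i\<in>I. S i \<subseteq> A \<and> \<not> null (S i)"
proof -
  have unc: "uncountable A"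
  proof
    assume "countable A"
    then have "|A| \<le>o natLeq" by (simp add: countable_card_le_natLeq)
    moreover have "natLeq <o |A|"
      using cardSuc_greater[OF natLeq_Card_order] A ordIso_symmetric ordLess_ordIso_trans by blast
    ultimately show False using not_ordLess_ordLeq by blast
  qed
  let ?r = "|A|"
  have wo: "Well_order ?r" and Fr: "Field ?r = A"
    by (rule card_of_Well_order, rule Field_card_of)
  \<comment> \<open>\<open>|A|\<close> is a well-order of minimal type, so its proper initial
    segments have cardinality below \<aleph>_1.\<close>
  have cnt: "countable (underS ?r a)" if "a \<in> A" for a
  proof -
    have "|underS ?r a| <o |A|" using that by (intro card_of_underS card_of_Card_order) (simp add: Fr)
    then have "|underS ?r a| <o cardSuc natLeq" using A ordLess_ordIso_trans by blast
    then have "|underS ?r a| \<le>o natLeq"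
      using cardSuc_ordLeq_ordLess[OF natLeq_Card_order card_of_Card_order] by blast
    then show ?thesis by (simp add: countable_card_le_natLeq)
  qed
  define f where "f a = to_nat_on (underS ?r a)" for a
  define U where "U n b = {a \<in> A. b \<in> underS ?r a \<and> f a b = n}" for n b
  \<comment> \<open>Column \<open>b\<close> covers all of \<open>A\<close> but \<open>b\<close> and
    its countably many predecessors, so not every entry in it can be null.\<close>
  have "\<exists>n. \<not> null (U n b)" if b: "b \<in> A" for b
  proof (rule ccontr)
    assume "\<not> ?thesis"
    then have "null (\<Union>n. U n b)" by (intro null_UN) auto
    moreover have "null (insert b (underS ?r b))"
      using b cnt Fr by (intro null_countable) (auto simp: underS_def Field_def)
    moreover have "A = (\<Union>n. U n b) \<union> insert b (underS ?r b)"
    proof -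
      have "b \<in> underS ?r a \<or> a = b \<or> a \<in> underS ?r b" if "a \<in> A" for a
        using wo b that Fr
        unfolding well_order_on_def linear_order_on_def total_on_def underS_def by blast
      moreover have "underS ?r b \<subseteq> A" using Fr by (auto simp: underS_def Field_def)
      ultimately show ?thesis using b by (auto simp: U_def)
    qed
    ultimately show False using null_Un \<open>\<not> null A\<close> by metis
  qed
  then obtain n where n: "\<And>b. b \<in> A \<Longrightarrow> \<not> null (U (n b) b)" by metis
  \<comment> \<open>Pigeonhole: uncountably many columns choose among countably many rows.\<close>
  have "\<exists>k. uncountable {b \<in> A. n b = k}"
  proof (rule ccontr)
    assume "\<not> ?thesis"
    then have "countable (\<Union>k. {b \<in> A. n b = k})" by (intro countable_UN) auto
    moreover have "(\<Union>k. {b \<in> A. n b = k}) = A" by blast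
    ultimately show False using unc by simp
  qed
  then obtain k where k: "uncountable {b \<in> A. n b = k}" ..
  show thesis
  proof (rule that[OF k])
    \<comment> \<open>Entries of one row are disjoint because \<open>f a\<close> is injective on the
      predecessors of \<open>a\<close>.\<close>
    have "b = c" if "a \<in> U k b" "a \<in> U k c" for a b c
      using that inj_onD[OF inj_on_to_nat_on[OF cnt[of a]], of b c]
      by (simp add: U_def f_def)
    then show "disjoint_family_on (U k) {b \<in> A. n b = k}"
      unfolding disjoint_family_on_def by blast
  qed (use n in \<open>auto simp: U_def\<close>)
qed

section \<open>Test regions and complements\<close>

lemma non_Baire_set_test_region:
  assumes "non_Baire_set X C S"
  obtains T where "test_region X C S T"
proof -
  have SX: "S \<subseteq> X" and "\<not> Baire_set X C S" using assms by (simp_all add: non_Baire_set_def)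
  then obtain T where T: "T \<in> C"
    "\<forall>B\<in>C. B \<subseteq> T \<longrightarrow> \<not> meager X C (S \<inter> B) \<and> \<not> meager X C ((X - S) \<inter> B)"
    by (auto simp: Baire_set_def meager_in_def)
  then have "test_region X C S T"
    using SX by (simp add: test_region_def abundant_in_def abundant_def le_infI1)
  then show thesis by (rule that)
qed

lemma test_region_Compl:
  assumes "S \<subseteq> X" "test_region X C S T"
  shows "test_region X C (X - S) T"
  using assms unfolding test_region_def by (simp add: double_diff)

lemma non_Baire_set_Compl:
  assumes "non_Baire_set X C S"
  shows "non_Baire_set X C (X - S)"
  using assms unfolding non_Baire_set_def Baire_set_def by (auto simp: double_diff)

section \<open>Baire bases with the countable chain condition\<close>

locale ccc_Baire_base =
  fixes X :: "'a set" and C :: "'a set set"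
  assumes base: "category_base X C" and baire: "Baire_base X C"
    and ccc: "countable_chain_condition C"
begin

lemma Union_regions: "\<Union>C = X"
  using base by (simp add: category_base_def)

lemma region_subset: "A \<in> C \<Longrightarrow> A \<subseteq> X"
  using Union_regions by blast

lemma region_not_meager: "A \<in> C \<Longrightarrow> \<not> meager X C A"
  using baire unfolding Baire_base_def abundant_def by blast

lemma region_nonempty: "A \<in> C \<Longrightarrow> A \<noteq> {}"
  using region_not_meager[of A] unfolding meager_def by (metis Sup_empty countable_empty empty_iff)

text \<open>The chain condition makes \<open>D\<close> countable, so its cardinality is below that
  of the uncountable \<open>C\<close> and axiom (2) applies; its clauses (i) and (ii) become the two
  cases.\<close>

lemma countable_family_cases:
  assumes "uncountable C" "A \<in> C" "D \<noteq> {}" "D \<subseteq> C" "disjoint D"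
  obtains E B where "E \<in> D" "B \<in> C" "B \<subseteq> A \<inter> E"
  | B where "B \<in> C" "B \<subseteq> A" "\<forall>E\<in>D. B \<inter> E = {}"
proof -
  have "countable D" using ccc assms unfolding countable_chain_condition_def by blast
  then have "|D| \<le>o natLeq" by (simp add: countable_card_le_natLeq)
  moreover have "natLeq <o |C|"
    using assms(1) natLeq_Well_order card_of_Well_order not_ordLeq_iff_ordLess
    by (metis countable_card_le_natLeq)
  ultimately have "|D| <o |C|" using ordLeq_ordLess_trans by blast
  then have D: "D \<noteq> {} \<and> D \<subseteq> C \<and> disjoint D \<and> |D| <o |C|" using assms by simp
  note axiom2 = base[unfolded category_base_def, THEN conjunct2, THEN conjunct2]
  show thesis
    using axiom2[THEN bspec, OF assms(2), THEN spec, THEN mp, OF D] that by metis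
qed

text \<open>An analogue of the Banach category theorem. Countably many regions in which
  \<open>S\<close> is meager are chosen so that every region has a subregion inside their union. The
  part of \<open>S\<close> in the union is then meager, and the rest is singular.\<close>

lemma locally_meager_imp_meager:
  assumes S: "S \<subseteq> X" and loc: "\<And>A. A \<in> C \<Longrightarrow> \<exists>B\<in>C. B \<subseteq> A \<and> meager X C (S \<inter> B)"
  shows "meager X C S"
proof -
  let ?P = "{B \<in> C. meager X C (S \<inter> B)}"
  obtain M where M: "M \<subseteq> ?P" "countable M" and dense: "\<And>A. A \<in> C \<Longrightarrow> \<exists>B\<in>C. B \<subseteq> A \<inter> \<Union>M"
  \<comment> \<open>If \<open>C\<close> is countable, a disjoint family may be as large as
    \<open>C\<close>, outside the reach of axiom (2); but then all of \<open>?P\<close> can serve as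
    \<open>M\<close>.\<close>
  proof (cases "countable C")
    case True
    show thesis
    proof (rule that[of ?P])
      show "countable ?P" using True by (rule countable_subset[rotated]) blast
      fix A assume "A \<in> C"
      then obtain B where "B \<in> ?P" "B \<subseteq> A" using loc by auto
      then show "\<exists>B\<in>C. B \<subseteq> A \<inter> \<Union>?P" by (intro bexI[of _ B]) auto
    qed simp
  next
    case False
    obtain M where M: "M \<subseteq> ?P" "disjoint M" "\<forall>B\<in>?P. B \<noteq> {} \<longrightarrow> (\<exists>E\<in>M. B \<inter> E \<noteq> {})"
      by (rule exists_maximal_disjoint_subfamily[of ?P])
    have max: "\<exists>E\<in>M. B \<inter> E \<noteq> {}" if "B \<in> ?P" for B
      using M(3)[rule_format, OF that] region_nonempty[of B] that by auto
    show thesis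
    proof (rule that[OF M(1)])
      show "countable M" using M ccc unfolding countable_chain_condition_def by blast
      fix A assume A: "A \<in> C"
      then obtain B where "B \<in> ?P" using loc by auto
      then have ne: "M \<noteq> {}" using max by blast
      have "M \<subseteq> C" using M(1) by blast
      from False A ne this M(2) show "\<exists>B\<in>C. B \<subseteq> A \<inter> \<Union>M"
      proof (cases rule: countable_family_cases)
        case (1 E B)
        then have "B \<subseteq> A \<inter> \<Union>M" by blast
        then show ?thesis using 1 by blast
      next
        case (2 B)
        \<comment> \<open>Such a \<open>B'\<close> could be added to \<open>M\<close>, against
          maximality.\<close>
        then obtain B' where "B' \<in> ?P" "B' \<subseteq> B" using loc[of B] by auto
        moreover have "B' \<inter> E = {}" if "E \<in> M" for E using 2(3) that \<open>B' \<subseteq> B\<close> by blast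
        ultimately show ?thesis using max[of B'] by blast
      qed
    qed
  qed
  have "meager X C (\<Union>B\<in>M. S \<inter> B)" using M by (intro meager_UN) auto
  moreover have "singular X C (S - \<Union>M)"
    unfolding singular_def
  proof (intro conjI ballI)
    fix A assume "A \<in> C"
    then obtain B where "B \<in> C" "B \<subseteq> A \<inter> \<Union>M" using dense by blast
    then show "\<exists>B\<in>C. B \<subseteq> A \<and> B \<inter> (S - \<Union>M) = {}" by (intro bexI[of _ B]) auto
  qed (use S in blast)
  ultimately have "meager X C ((\<Union>B\<in>M. S \<inter> B) \<union> (S - \<Union>M))"
    by (rule meager_Un[OF _ singular_imp_meager])
  then show ?thesis by (rule meager_subset) blast
qed

text \<open>An abundant set cannot be locally meager, so it is abundant in every subregion of some
  \<open>A\<close>. Below \<open>A\<close> the Baire property leaves only the alternative that the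
  complement is meager.\<close>

lemma abundant_Baire_set_comeager_in_region:
  assumes "Baire_set X C S" "\<not> meager X C S"
  obtains B where "B \<in> C" "meager X C (B - S)"
proof -
  have SX: "S \<subseteq> X" using assms(1) unfolding Baire_set_def by blast
  obtain A where A: "A \<in> C" "\<forall>B\<in>C. B \<subseteq> A \<longrightarrow> \<not> meager X C (S \<inter> B)"
    using locally_meager_imp_meager[OF SX] assms(2) by metis
  then obtain B where B: "B \<in> C" "meager X C ((X - S) \<inter> B)"
    using assms(1) A unfolding Baire_set_def meager_in_def by metis
  moreover have "B \<subseteq> X" using B(1) by (rule region_subset)
  then have "B - S \<subseteq> (X - S) \<inter> B" by blast
  ultimately show thesis using that meager_subset by blast
qed

text \<open>Extends the chain condition from disjoint regions to regions that may overlap without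
  sharing a subregion. A maximal disjoint family of regions inside the \<open>B i\<close> is
  countable, and each index is recovered from one of its members.\<close>

lemma countable_if_no_common_subregion:
  assumes B: "\<And>i. i \<in> I \<Longrightarrow> B i \<in> C"
    and incomp: "\<And>i j E. \<lbrakk>i \<in> I; j \<in> I; E \<in> C; E \<subseteq> B i; E \<subseteq> B j\<rbrakk> \<Longrightarrow> i = j"
  shows "countable I"
proof (cases "countable C")
  case True
  have "inj_on B I" using B incomp by (intro inj_onI) blast
  moreover have "countable (B ` I)" using True B by (meson countable_subset image_subsetI)
  ultimately show ?thesis using countable_image_inj_on by blast
next
  case False
  let ?P = "{E \<in> C. \<exists>i\<in>I. E \<subseteq> B i}"
  obtain M where M: "M \<subseteq> ?P" "disjoint M" "\<forall>E\<in>?P. E \<noteq> {} \<longrightarrow> (\<exists>D\<in>M. E \<inter> D \<noteq> {})"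
    by (rule exists_maximal_disjoint_subfamily[of ?P])
  have max: "\<exists>D\<in>M. E \<inter> D \<noteq> {}" if "E \<in> ?P" for E
    using M(3)[rule_format, OF that] region_nonempty[of E] that by auto
  define g where "g E = (SOME i. i \<in> I \<and> E \<subseteq> B i)" for E
  have g: "g E \<in> I \<and> E \<subseteq> B (g E)" if "E \<in> M" for E
    unfolding g_def by (rule someI_ex) (use that M in blast)
  have "I \<subseteq> g ` M"
  proof
    fix i assume i: "i \<in> I"
    have ne: "M \<noteq> {}" using max[of "B i"] B i by blast
    have "M \<subseteq> C" using M by blast
    from False B[OF i] ne this M(2) show "i \<in> g ` M"
    proof (cases rule: countable_family_cases)
      case (1 E D)
      \<comment> \<open>\<open>D\<close> lies in \<open>B i\<close> and, through \<open>E\<close>,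
        in \<open>B (g E)\<close>, so it is a common subregion.\<close>
      then have "i = g E" using incomp[of i "g E" D] i g[OF 1(1)] by blast
      then show ?thesis using 1 by blast
    next
      case (2 D)
      then show ?thesis using max[of D] i by blast
    qed
  qed
  moreover have "countable M" using M ccc unfolding countable_chain_condition_def by blast
  ultimately show ?thesis by (meson countable_image countable_subset)
qed

lemma countable_disjoint_abundant_Baire_sets:
  assumes "disjoint_family_on S I"
    and S: "\<And>i. i \<in> I \<Longrightarrow> Baire_set X C (S i) \<and> \<not> meager X C (S i)"
  shows "countable I"
proof -
  have "\<forall>i\<in>I. \<exists>B. B \<in> C \<and> meager X C (B - S i)"
    using S abundant_Baire_set_comeager_in_region by metis
  then obtain B where B: "\<And>i. i \<in> I \<Longrightarrow> B i \<in> C \<and> meager X C (B i - S i)" by metis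
  show ?thesis
  proof (rule countable_if_no_common_subregion)
    fix i j E assume ij: "i \<in> I" "j \<in> I" and E: "E \<in> C" "E \<subseteq> B i" "E \<subseteq> B j"
    show "i = j"
    proof (rule ccontr)
      assume "i \<noteq> j"
      then have "S i \<inter> S j = {}" using assms(1) ij by (auto simp: disjoint_family_on_def)
      \<comment> \<open>No point lies in both \<open>S i\<close> and \<open>S j\<close>, so two
        meager sets would cover the abundant region \<open>E\<close>.\<close>
      then have "E \<subseteq> (B i - S i) \<union> (B j - S j)" using E by blast
      moreover have "meager X C ((B i - S i) \<union> (B j - S j))" using B ij meager_Un by blast
      ultimately show False using meager_subset region_not_meager E(1) by blast
    qed
  qed (use B in blast)
qed

lemma exists_non_Baire_set:
  assumes pm: "point_meager X C" and A: "A \<in> C" "|A| =o cardSuc natLeq"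
  obtains S where "non_Baire_set X C S"
proof -
  have AX: "A \<subseteq> X" using A(1) by (rule region_subset)
  obtain I :: "'a set" and S where I: "uncountable I" "disjoint_family_on S I"
    and S: "\<forall>i\<in>I. S i \<subseteq> A \<and> \<not> meager X C (S i)"
  proof (rule Ulam_matrix[of A "meager X C"])
    show "meager X C (\<Union>n. T n)" if "\<And>n. meager X C (T n)" for T :: "nat \<Rightarrow> 'a set"
      using that by (intro meager_UN) auto
    show "meager X C T" if "T \<subseteq> A" "countable T" for T
      using that AX pm by (auto simp: point_meager_def)
    show "\<not> meager X C A" using A(1) by (rule region_not_meager)
  qed (rule A(2), erule (1) meager_Un)
  \<comment> \<open>If every \<open>S i\<close> were Baire, the uncountable \<open>I\<close> would
    be countable.\<close>
  then show thesis
    using countable_disjoint_abundant_Baire_sets[OF I(2)] I(1) S AX that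
    unfolding non_Baire_set_def by (meson subset_trans)
qed

end

section \<open>Decomposition into a set and its complement\<close>

theorem theorem11:
  fixes X :: "'a set" and C :: "'a set set"
  assumes "category_base X C"
    and "point_meager X C"
    and "Baire_base X C"
    and "countable_chain_condition C"
    and "\<And>A. A \<in> C \<Longrightarrow> |A| =o cardSuc natLeq"
  shows "\<exists>F. uniform_non_Baire_family X C F \<and> partition_on X F"
proof -
  interpret ccc_Baire_base X C by unfold_locales (use assms in auto)
  obtain A where "A \<in> C" using assms(1) Union_regions by (auto simp: category_base_def)
  then obtain S where S: "non_Baire_set X C S"
    using exists_non_Baire_set assms(2,5) by blast
  then have SX: "S \<subseteq> X" unfolding non_Baire_set_def by blast
  obtain T where T: "test_region X C S T" using S non_Baire_set_test_region by blast
  have TC: "T \<in> C" using T unfolding test_region_def by blast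
  have "uniform_non_Baire_family X C {S, X - S}"
    unfolding uniform_non_Baire_family_def
    using S T TC non_Baire_set_Compl[OF S] test_region_Compl[OF SX T] by blast
  moreover have "S \<noteq> {}" "X - S \<noteq> {}"
  proof -
    \<comment> \<open>A partition has no empty member. Both sets are abundant in \<open>T\<close>,
      whereas the empty set is meager as the empty union.\<close>
    have "\<not> meager X C (S \<inter> T)" "\<not> meager X C ((X - S) \<inter> T)"
      using T TC unfolding test_region_def abundant_in_def abundant_def by blast+
    moreover have "meager X C {}" unfolding meager_def by (rule exI[of _ "{}"]) simp
    ultimately show "S \<noteq> {}" "X - S \<noteq> {}" by (metis Int_empty_left)+
  qed
  then have "partition_on X {S, X - S}"
    using SX by (auto simp: partition_on_def disjoint_def)
  ultimately show ?thesis by blast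
qed

end
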